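(* Let $k=\omega(1)$, let $c_1,c_2\in(0,1]$, and let $d\le c_1(1-c_2)k$. Let $G$ be a graph on more than $k$ vertices, with maximum degree $d$, and with $i_k(G)\ge c_1d$. Let $\epsilon>0$ be sufficiently small, and let $p=\frac{1+\epsilon}{c_2c_1d}$. Then, with probability tending to $1$ as $k\to\infty$, $G_p$ contains a component of order at least $\frac{c_1(1-c_2)k}{4}$.
   Context: $G_p$ denotes the random subgraph of $G$ obtained by retaining each edge independently with probability $p$. For $S\subseteq V(G)$, $\partial_G(S)$ is the number of edges of $G$ with exactly one endpoint in $S$. For an $n$-vertex graph $H$ and $I\subseteq[n]$, $i_I(H)=\min\{\partial_H(S)/|S| : S\subseteq V(H),\ |S|\in I\}$, and $i_k(H)=i_{\{k\}}(H)$, i.e. the minimum of $\partial_H(S)/|S|$ over sets $S$ of size exactly $k$. *)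

theory Defs
  imports "HOL-Probability.Probability"
begin

text \<open>A finite simple graph is given by its vertex set \<open>V\<close> and its set \<open>E\<close> of two-element edges.\<close>

definition simple_graph :: "'a set \<Rightarrow> 'a set set \<Rightarrow> bool" where
  "simple_graph V E \<longleftrightarrow> finite V \<and> E \<subseteq> {{u, v} | u v. u \<in> V \<and> v \<in> V \<and> u \<noteq> v}"

definition vertex_degree :: "'a set set \<Rightarrow> 'a \<Rightarrow> nat" where
  "vertex_degree E v = card {e \<in> E. v \<in> e}"

definition max_degree :: "'a set \<Rightarrow> 'a set set \<Rightarrow> nat" where
  "max_degree V E = Max (vertex_degree E ` V)"

definition edge_boundary :: "'a set set \<Rightarrow> 'a set \<Rightarrow> nat" where
  "edge_boundary E S = card {e \<in> E. card (e \<inter> S) = 1}"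

text \<open>Meaningful when \<open>V\<close> is finite and \<open>I\<close> contains some size between 1 and \<open>card V\<close> but not 0;
  otherwise the value is arbitrary.\<close>

definition iso_const :: "'a set \<Rightarrow> 'a set set \<Rightarrow> nat set \<Rightarrow> real" where
  "iso_const V E I = Min {real (edge_boundary E S) / real (card S) | S. S \<subseteq> V \<and> card S \<in> I}"

definition iso_const_at :: "'a set \<Rightarrow> 'a set set \<Rightarrow> nat \<Rightarrow> real" where
  "iso_const_at V E k = iso_const V E {k}"

definition component_of :: "'a set set \<Rightarrow> 'a \<Rightarrow> 'a set" where
  "component_of E v = {w. (\<lambda>x y. {x, y} \<in> E)\<^sup>*\<^sup>* v w}"

definition graph_components :: "'a set \<Rightarrow> 'a set set \<Rightarrow> 'a set set" where
  "graph_components V E = component_of E ` V"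

text \<open>The distribution of the edge set of the random subgraph (the vertex set is unchanged).
  The library's Bernoulli distribution truncates its parameter to the unit interval,
  so all edges are retained when \<open>p \<ge> 1\<close>.\<close>

definition random_subgraph :: "'a set set \<Rightarrow> real \<Rightarrow> 'a set set pmf" where
  "random_subgraph E p =
     map_pmf (\<lambda>X. {e \<in> E. X e}) (Pi_pmf E False (\<lambda>_. bernoulli_pmf p))"

end

theory Submission
  imports Defs
begin

text \<open>Reveal the random subgraph by growing one component after another until \<open>k\<close> vertices have
  been visited. At most \<open>k\<close> queried edges are then present. If all components have fewer than
  \<open>c1 (1 - c2) k\<close> vertices, the component under exploration meets fewer than \<open>c1 (1 - c2) k d\<close>
  edges, so at least \<open>c1 c2 d k\<close> of the at least \<open>c1 d k\<close> boundary edges of the visited set have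
  been queried and are absent. Comparing the probability of each such history with its probability
  under the retention probability \<open>p / (1 + \<epsilon>) = 1 / (c2 c1 d)\<close> gives a likelihood ratio of at most
  \<open>((1 + \<epsilon>) exp (-\<epsilon>)) ^ k\<close>, and distinct histories are disjoint events.\<close>

lemma component_of_mono: "P \<subseteq> F \<Longrightarrow> component_of P v \<subseteq> component_of F v"
  unfolding component_of_def using rtranclp_mono[of "\<lambda>x y. {x, y} \<in> P" "\<lambda>x y. {x, y} \<in> F"] by blast

lemma component_of_step: "u \<in> component_of P r \<Longrightarrow> {u, v} \<in> P \<Longrightarrow> v \<in> component_of P r"
  unfolding component_of_def by (auto intro: rtranclp.rtrancl_into_rtrancl)

lemma component_of_self: "v \<in> component_of P v"
  unfolding component_of_def by auto

lemma component_of_subset: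
  assumes "simple_graph V E" "F \<subseteq> E" "v \<in> V"
  shows "component_of F v \<subseteq> V"
proof
  fix w assume "w \<in> component_of F v"
  then have "(\<lambda>x y. {x, y} \<in> F)\<^sup>*\<^sup>* v w" by (simp add: component_of_def)
  then show "w \<in> V"
  proof (induction rule: rtranclp_induct)
    case base
    then show ?case using assms by simp
  next
    case (step y z)
    then have "{y, z} \<in> E" using assms(2) by auto
    then obtain u u' where "{y, z} = {u, u'}" "u \<in> V" "u' \<in> V"
      using assms(1) unfolding simple_graph_def by blast
    then show ?case by (auto simp: doubleton_eq_iff)
  qed
qed

lemma simple_graph_edge_cases:
  assumes "simple_graph V E" "e \<in> E"
  obtains u v where "e = {u, v}" "u \<in> V" "v \<in> V" "u \<noteq> v"
  using assms unfolding simple_graph_def by blast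

lemma simple_graph_finite_edges:
  assumes "simple_graph V E"
  shows "finite E"
proof (rule finite_subset)
  show "E \<subseteq> Pow V" using assms unfolding simple_graph_def by blast
  show "finite (Pow V)" using assms unfolding simple_graph_def by simp
qed

lemma crossing_doubleton_iff:
  assumes "u \<noteq> v"
  shows "card ({u, v} \<inter> W) = 1 \<longleftrightarrow> (u \<in> W \<and> v \<notin> W) \<or> (v \<in> W \<and> u \<notin> W)"
  using assms by (cases "u \<in> W"; cases "v \<in> W") auto

text \<open>In the state \<open>(W, C, P, N)\<close>, \<open>W\<close> is the set of visited vertices, \<open>C\<close> the visited part of the
  component under exploration, and \<open>P\<close>, \<open>N\<close> are the edges queried so far that turned out to be
  present and absent. The bound is the probability of the history under a modified retention
  probability \<open>a\<close>, times a bound \<open>D\<close> for the likelihood ratio at the end of the exploration.\<close>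

lemma exploration_bound:
  fixes M :: "'a set set pmf" and V :: "'a set" and E :: "'a set set" and a b p q D L m :: real
  defines "bad \<equiv> {F. F \<subseteq> E \<and> (\<forall>C\<in>graph_components V F. real (card C) < m)}"
  assumes graph: "simple_graph V E" and kV: "k \<le> card V"
    and cyl: "\<And>P N. P \<subseteq> E \<Longrightarrow> N \<subseteq> E \<Longrightarrow> P \<inter> N = {} \<Longrightarrow>
        measure_pmf.prob M {F. P \<subseteq> F \<and> F \<inter> N = {}} \<le> p ^ card P * q ^ card N"
    and expand: "\<And>W C. W \<subseteq> V \<Longrightarrow> card W = k \<Longrightarrow> C \<subseteq> W \<Longrightarrow> real (card C) < m \<Longrightarrow>
        L \<le> real (card {e \<in> E. card (e \<inter> W) = 1 \<and> e \<inter> C = {}})"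
    and ratio: "\<And>i j. i \<le> k \<Longrightarrow> L \<le> real j \<Longrightarrow> p ^ i * q ^ j \<le> a ^ i * b ^ j * D"
    and ab: "0 \<le> a" "0 \<le> b" "a + b \<le> 1" and D: "0 \<le> D"
    and W: "W \<subseteq> V" "card W \<le> k" and C: "C \<subseteq> W" "r \<in> V" "C \<subseteq> component_of P r"
    and P: "P \<subseteq> E" "\<Union>P \<subseteq> W" "card P \<le> card W" and N: "N \<subseteq> E" "P \<inter> N = {}"
    and closed: "\<And>e. e \<in> E \<Longrightarrow> card (e \<inter> W) = 1 \<Longrightarrow> e \<inter> C = {} \<Longrightarrow> e \<in> N"
  shows "measure_pmf.prob M {F \<in> bad. P \<subseteq> F \<and> F \<inter> N = {}} \<le> a ^ card P * b ^ card N * D"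
  using W C P N closed
proof (induction "k - card W + card (E - N)" arbitrary: W C P N r rule: less_induct)
  case less
  note W = less.prems(1,2) and C = less.prems(3-5) and P = less.prems(6-8)
    and N = less.prems(9,10) and closed = less.prems(11)
  have finV: "finite V" using graph by (simp add: simple_graph_def)
  have finE: "finite E" using graph by (rule simple_graph_finite_edges)
  have finW: "finite W" using W(1) finV finite_subset by blast
  have finP: "finite P" and finN: "finite N" using P(1) N(1) finE finite_subset by blast+
  show ?case
  proof (cases "card W = k")
    case True
    show ?thesis
    proof (cases "{F \<in> bad. P \<subseteq> F \<and> F \<inter> N = {}} = {}")
      case True
      then show ?thesis using ab D by (metis measure_empty mult_nonneg_nonneg zero_le_power)
    next
      case False
      then obtain F where F: "F \<in> bad" "P \<subseteq> F" by blast
      have "component_of F r \<subseteq> V"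
        using component_of_subset[OF graph _ C(2)] F(1) by (simp add: bad_def)
      then have "card C \<le> card (component_of F r)"
        using component_of_mono[OF F(2), of r] C(3) finV
        by (meson card_mono finite_subset subset_trans)
      moreover have "real (card (component_of F r)) < m"
        using F(1) C(2) by (auto simp: bad_def graph_components_def)
      ultimately have "L \<le> real (card {e \<in> E. card (e \<inter> W) = 1 \<and> e \<inter> C = {}})"
        using expand[OF W(1) True C(1)] by linarith
      also have "\<dots> \<le> real (card N)"
        using closed finN by (intro of_nat_mono card_mono) auto
      finally have LN: "L \<le> real (card N)" .
      have "measure_pmf.prob M {F \<in> bad. P \<subseteq> F \<and> F \<inter> N = {}}
          \<le> measure_pmf.prob M {F. P \<subseteq> F \<and> F \<inter> N = {}}"
        by (rule measure_pmf.finite_measure_mono) auto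
      also have "\<dots> \<le> p ^ card P * q ^ card N" using cyl P(1) N by blast
      also have "\<dots> \<le> a ^ card P * b ^ card N * D" using ratio P(3) True LN by simp
      finally show ?thesis .
    qed
  next
    case False
    then have Wk: "card W < k" using W(2) by simp
    show ?thesis
    proof (cases "\<exists>e\<in>E. card (e \<inter> W) = 1 \<and> e \<notin> N")
      case True
      then obtain e where e: "e \<in> E" "card (e \<inter> W) = 1" "e \<notin> N" by blast
      have eC: "e \<inter> C \<noteq> {}" using closed e by blast
      obtain u v where uv: "e = {u, v}" "u \<in> C" "u \<in> W" "v \<notin> W" "v \<in> V" "u \<noteq> v"
      proof -
        obtain x y where xy: "e = {x, y}" "x \<in> V" "y \<in> V" "x \<noteq> y"
          using simple_graph_edge_cases[OF graph e(1)] by metis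
        then have "(x \<in> W \<and> y \<notin> W) \<or> (y \<in> W \<and> x \<notin> W)"
          using e(2) crossing_doubleton_iff by metis
        then show thesis
          using that[of x y] that[of y x] xy eC C(1) by (auto simp: insert_commute)
      qed
      have eP: "e \<notin> P" using P(2) uv by blast
      have card_W': "card (insert v W) = Suc (card W)" using finW uv by simp
      have pos: "measure_pmf.prob M {F \<in> bad. insert e P \<subseteq> F \<and> F \<inter> N = {}}
          \<le> a ^ card (insert e P) * b ^ card N * D"
      proof (rule less.hyps[of "insert v W" N "insert v C" r "insert e P"])
        show "k - card (insert v W) + card (E - N) < k - card W + card (E - N)"
          using card_W' Wk by simp
        show "insert v C \<subseteq> component_of (insert e P) r"
        proof -
          have "C \<subseteq> component_of (insert e P) r"
            using C(3) component_of_mono[of P "insert e P" r] by blast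
          then show ?thesis
            using component_of_step[of u "insert e P" r v] uv by blast
        qed
        show "card (insert e P) \<le> card (insert v W)"
          using P(3) card_W' finP eP by simp
        show "f \<in> N" if f: "f \<in> E" "card (f \<inter> insert v W) = 1" "f \<inter> insert v C = {}" for f
        proof -
          have "f \<inter> insert v W = f \<inter> W" using f(3) by blast
          then show ?thesis using closed f by auto
        qed
        show "insert v W \<subseteq> V" "card (insert v W) \<le> k" using W uv card_W' Wk by auto
        show "insert v C \<subseteq> insert v W" "r \<in> V" using C by auto
        show "insert e P \<subseteq> E" "N \<subseteq> E" "insert e P \<inter> N = {}" using P(1) N e by auto
        show "\<Union> (insert e P) \<subseteq> insert v W" using P(2) uv by auto
      qed
      have neg: "measure_pmf.prob M {F \<in> bad. P \<subseteq> F \<and> F \<inter> insert e N = {}}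
          \<le> a ^ card P * b ^ card (insert e N) * D"
      proof (rule less.hyps[of W "insert e N" C r P])
        have "card (E - insert e N) < card (E - N)"
          using e finE by (intro psubset_card_mono) auto
        then show "k - card W + card (E - insert e N) < k - card W + card (E - N)" by simp
      qed (use W C P N e eP closed in auto)
      have "measure_pmf.prob M {F \<in> bad. P \<subseteq> F \<and> F \<inter> N = {}}
          = measure_pmf.prob M ({F \<in> bad. insert e P \<subseteq> F \<and> F \<inter> N = {}}
              \<union> {F \<in> bad. P \<subseteq> F \<and> F \<inter> insert e N = {}})"
        using e(3) by (intro arg_cong[where f = "measure_pmf.prob M"]) auto
      also have "\<dots> \<le> measure_pmf.prob M {F \<in> bad. insert e P \<subseteq> F \<and> F \<inter> N = {}}
          + measure_pmf.prob M {F \<in> bad. P \<subseteq> F \<and> F \<inter> insert e N = {}}"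
        by (rule measure_Un_le) auto
      also have "\<dots> \<le> (a + b) * (a ^ card P * b ^ card N * D)"
        using pos neg finP finN eP e(3) by (simp add: algebra_simps)
      also have "\<dots> \<le> 1 * (a ^ card P * b ^ card N * D)"
        using ab D by (intro mult_right_mono) auto
      finally show ?thesis by simp
    next
      case False
      obtain v where v: "v \<in> V" "v \<notin> W"
        using Wk kV W(1) by (metis leD subsetI subset_antisym)
      have card_W': "card (insert v W) = Suc (card W)" using finW v by simp
      show ?thesis
      proof (rule less.hyps[of "insert v W" N "{v}" v P])
        show "k - card (insert v W) + card (E - N) < k - card W + card (E - N)"
          using card_W' Wk by simp
        show "{v} \<subseteq> component_of P v" by (simp add: component_of_self)
        show "f \<in> N" if f: "f \<in> E" "card (f \<inter> insert v W) = 1" "f \<inter> {v} = {}" for f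
        proof -
          have "f \<inter> insert v W = f \<inter> W" using f(3) by blast
          then show ?thesis using False f by auto
        qed
      qed (use W Wk card_W' v P N in auto)
    qed
  qed
qed

lemma prob_random_subgraph_cylinder:
  assumes "finite E" "P \<subseteq> E" "N \<subseteq> E" "P \<inter> N = {}" "0 \<le> p" "p \<le> 1"
  shows "measure_pmf.prob (random_subgraph E p) {F. P \<subseteq> F \<and> F \<inter> N = {}}
    = p ^ card P * (1 - p) ^ card N"
proof -
  define B where "B e = (if e \<in> P then {True} else if e \<in> N then {False} else UNIV)" for e
  have "measure_pmf.prob (random_subgraph E p) {F. P \<subseteq> F \<and> F \<inter> N = {}}
    = measure_pmf.prob (Pi_pmf E False (\<lambda>_. bernoulli_pmf p)) (Pi E B)"
    unfolding random_subgraph_def measure_map_pmf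
    using assms(2-4) by (intro arg_cong[where f = "measure_pmf.prob _"])
      (auto simp: B_def Pi_def split: if_splits)
  also have "\<dots> = (\<Prod>e\<in>E. measure_pmf.prob (bernoulli_pmf p) (B e))"
    using assms(1) by (rule measure_Pi_pmf_Pi)
  also have "\<dots> = (\<Prod>e\<in>E. (if e \<in> P then p else 1) * (if e \<in> N then 1 - p else 1))"
    using assms(4-6) by (intro prod.cong) (auto simp: B_def measure_pmf_single)
  also have "\<dots> = p ^ card P * (1 - p) ^ card N"
    using assms(1-3) by (simp add: prod.distrib prod.If_cases Int_absorb1)
  finally show ?thesis .
qed

lemma random_subgraph_truncate:
  "random_subgraph E (min 1 p) = random_subgraph E p"
proof -
  have "bernoulli_pmf (min 1 p) = bernoulli_pmf p"
    by (rule pmf_eqI) (auto simp: bernoulli_pmf.rep_eq min_def max_def)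
  then show ?thesis by (simp add: random_subgraph_def)
qed

lemma set_random_subgraph: "F \<in> set_pmf (random_subgraph E p) \<Longrightarrow> F \<subseteq> E"
  by (auto simp: random_subgraph_def)

lemma card_edges_meeting_le:
  assumes "finite E" "finite C" "\<And>v. v \<in> C \<Longrightarrow> vertex_degree E v \<le> d"
  shows "card {e \<in> E. e \<inter> C \<noteq> {}} \<le> card C * d"
proof -
  have "{e \<in> E. e \<inter> C \<noteq> {}} = (\<Union>v\<in>C. {e \<in> E. v \<in> e})" by auto
  also have "card \<dots> \<le> (\<Sum>v\<in>C. card {e \<in> E. v \<in> e})"
    using assms(2) by (rule card_UN_le)
  also have "\<dots> \<le> (\<Sum>v\<in>C. d)"
    using assms(3) by (intro sum_mono) (simp add: vertex_degree_def)
  finally show ?thesis by simp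
qed

lemma iso_const_at_le:
  assumes "finite V" "S \<subseteq> V" "card S = k"
  shows "iso_const_at V E k \<le> real (edge_boundary E S) / real k"
proof -
  have "finite {real (edge_boundary E S) / real (card S) | S. S \<subseteq> V \<and> card S \<in> {k}}"
    by (rule finite_subset[of _ "(\<lambda>S. real (edge_boundary E S) / real (card S)) ` Pow V"])
      (use assms(1) in auto)
  then show ?thesis
    unfolding iso_const_at_def iso_const_def using assms by (intro Min_le) auto
qed

lemma likelihood_ratio_bound:
  fixes p \<epsilon> L :: real
  assumes "0 \<le> p" "p \<le> 1" "0 < \<epsilon>" "i \<le> k" "L \<le> real j" "(1 + \<epsilon>) * real k \<le> p * L"
  defines "a \<equiv> p / (1 + \<epsilon>)"
  shows "p ^ i * (1 - p) ^ j \<le> a ^ i * (1 - a) ^ j * ((1 + \<epsilon>) * exp (- \<epsilon>)) ^ k"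
proof -
  have a: "0 \<le> a" "a \<le> 1" "p = a * (1 + \<epsilon>)"
    using assms by (auto simp: a_def field_simps)
  have kL: "real k \<le> a * L" using assms(3,6) by (simp add: a_def field_simps)
  have "p ^ i = a ^ i * (1 + \<epsilon>) ^ i" by (simp add: a(3) power_mult_distrib)
  also have "\<dots> \<le> a ^ i * (1 + \<epsilon>) ^ k"
    using a(1,2) assms(1-6) by (intro mult_left_mono power_increasing) auto
  finally have 1: "p ^ i \<le> a ^ i * (1 + \<epsilon>) ^ k" .
  have "a * (a * \<epsilon>) \<ge> 0" using a(1,2) assms(1-6) by simp
  then have "1 - p \<le> (1 - a) * (1 - \<epsilon> * a)" by (simp add: a(3) algebra_simps)
  also have "\<dots> \<le> (1 - a) * exp (- (\<epsilon> * a))"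
    using a(1,2) exp_ge_add_one_self[of "- (\<epsilon> * a)"] by (intro mult_left_mono) auto
  finally have "(1 - p) ^ j \<le> ((1 - a) * exp (- (\<epsilon> * a))) ^ j"
    using assms(1-6) by (intro power_mono) auto
  also have "\<dots> = (1 - a) ^ j * exp (- (\<epsilon> * (a * real j)))"
    by (simp add: power_mult_distrib exp_of_nat_mult[symmetric] mult_ac)
  also have "\<dots> \<le> (1 - a) ^ j * exp (- (\<epsilon> * real k))"
  proof -
    have "a * L \<le> a * real j" using a(1,2) assms(1-6) by (intro mult_left_mono) auto
    then show ?thesis using kL a(1,2) assms(1-6) by (intro mult_left_mono) auto
  qed
  finally have 2: "(1 - p) ^ j \<le> (1 - a) ^ j * exp (- \<epsilon>) ^ k"
    by (simp add: exp_of_nat_mult[symmetric] mult_ac)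
  have "p ^ i * (1 - p) ^ j \<le> (a ^ i * (1 + \<epsilon>) ^ k) * ((1 - a) ^ j * exp (- \<epsilon>) ^ k)"
    using 1 2 a(1,2) assms(1-6) by (intro mult_mono) auto
  then show ?thesis by (simp add: power_mult_distrib mult_ac)
qed

lemma prob_no_large_component_le:
  fixes c1 c2 \<epsilon> p m :: real
  assumes c: "0 < c1" "0 < c2" and \<epsilon>: "0 < \<epsilon>"
    and graph: "simple_graph V E" and kV: "k \<le> card V" and k: "0 < k" and d: "0 < d"
    and deg: "max_degree V E = d" and iso: "iso_const_at V E k \<ge> c1 * real d"
    and m: "m \<le> c1 * (1 - c2) * real k" and p: "p = (1 + \<epsilon>) / (c2 * c1 * real d)"
  shows "measure_pmf.prob (random_subgraph E p)
      {F. \<not> (\<exists>C\<in>graph_components V F. real (card C) \<ge> m)} \<le> ((1 + \<epsilon>) * exp (- \<epsilon>)) ^ k"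
proof -
  have finV: "finite V" using graph by (simp add: simple_graph_def)
  have finE: "finite E" using graph by (rule simple_graph_finite_edges)
  define L where "L = c1 * c2 * real d * real k"
  define p' where "p' = min 1 p"
  define D where "D = ((1 + \<epsilon>) * exp (- \<epsilon>)) ^ k"
  have p0: "0 < p" using p c \<epsilon> d by simp
  then have p': "0 \<le> p'" "p' \<le> 1" by (auto simp: p'_def)
  have D: "0 \<le> D" using \<epsilon> by (simp add: D_def)
  have L: "0 < L" using c d k by (simp add: L_def)
  have expand: "L \<le> real (card {e \<in> E. card (e \<inter> W) = 1 \<and> e \<inter> C = {}})"
    if W: "W \<subseteq> V" "card W = k" and C: "C \<subseteq> W" "real (card C) < m" for W C
  proof -
    have finC: "finite C" using W C finV by (meson finite_subset)
    have "vertex_degree E v \<le> d" if "v \<in> C" for v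
      using that W C finV deg by (auto simp: max_degree_def intro!: Max_ge)
    then have meet: "real (card {e \<in> E. e \<inter> C \<noteq> {}}) \<le> real (card C) * real d"
      using card_edges_meeting_le[OF finE finC, of d] by (simp flip: of_nat_mult)
    have "c1 * real d \<le> real (edge_boundary E W) / real k"
      using iso iso_const_at_le[OF finV W, of E] by linarith
    then have bd: "c1 * real d * real k \<le> real (edge_boundary E W)"
      using k by (simp add: field_simps)
    have "edge_boundary E W
        \<le> card ({e \<in> E. card (e \<inter> W) = 1 \<and> e \<inter> C = {}} \<union> {e \<in> E. e \<inter> C \<noteq> {}})"
      unfolding edge_boundary_def using finE by (intro card_mono) auto
    also have "\<dots> \<le> card {e \<in> E. card (e \<inter> W) = 1 \<and> e \<inter> C = {}} + card {e \<in> E. e \<inter> C \<noteq> {}}"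
      by (rule card_Un_le)
    finally have split: "real (edge_boundary E W)
        \<le> real (card {e \<in> E. card (e \<inter> W) = 1 \<and> e \<inter> C = {}})
          + real (card {e \<in> E. e \<inter> C \<noteq> {}})" by (simp flip: of_nat_add)
    have "real (card C) * real d \<le> c1 * (1 - c2) * real k * real d"
      using C(2) m by (intro mult_right_mono) auto
    then show ?thesis using split bd meet by (simp add: L_def algebra_simps)
  qed
  obtain a b where ab: "0 \<le> a" "0 \<le> b" "a + b \<le> 1"
    and ratio: "\<And>i j. i \<le> k \<Longrightarrow> L \<le> real j \<Longrightarrow> p' ^ i * (1 - p') ^ j \<le> a ^ i * b ^ j * D"
  proof (cases "p \<ge> 1")
    case True
    then have "p' = 1" by (simp add: p'_def)
    then show thesis using that[of 1 0] L D by (auto simp: power_0_left)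
  next
    case False
    then have "p' = p" by (simp add: p'_def)
    moreover have "p * L = (1 + \<epsilon>) * real k"
      using c d by (simp add: p L_def field_simps)
    moreover have "p \<le> 1 + \<epsilon>" using False \<epsilon> by simp
    ultimately show thesis
      using that[of "p / (1 + \<epsilon>)" "1 - p / (1 + \<epsilon>)"] likelihood_ratio_bound[of p \<epsilon> _ k L]
        p' p0 \<epsilon> unfolding D_def by simp
  qed
  obtain r where r: "r \<in> V" using kV k by fastforce
  let ?bad = "{F. F \<subseteq> E \<and> (\<forall>C\<in>graph_components V F. real (card C) < m)}"
  have "measure_pmf.prob (random_subgraph E p') {F \<in> ?bad. {} \<subseteq> F \<and> F \<inter> {} = {}}
      \<le> a ^ card ({} :: 'a set set) * b ^ card ({} :: 'a set set) * D"
  proof (rule exploration_bound[where p = p' and q = "1 - p'" and a = a and b = b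
        and P = "{}" and N = "{}" and W = "{}" and C = "{}" and r = r and k = k and L = L])
    show "measure_pmf.prob (random_subgraph E p') {F. P \<subseteq> F \<and> F \<inter> N = {}}
        \<le> p' ^ card P * (1 - p') ^ card N" if "P \<subseteq> E" "N \<subseteq> E" "P \<inter> N = {}" for P N
      using prob_random_subgraph_cylinder[OF finE that p'] by simp
  qed (use graph kV expand ratio ab D r in auto)
  then have *: "measure_pmf.prob (random_subgraph E p) ?bad \<le> D"
    by (simp add: p'_def random_subgraph_truncate)
  have "measure_pmf.prob (random_subgraph E p)
      {F. \<not> (\<exists>C\<in>graph_components V F. real (card C) \<ge> m)}
    = measure_pmf.prob (random_subgraph E p) ?bad"
    by (rule measure_prob_cong_0) (auto simp: not_le simp flip: set_pmf_iff dest!: set_random_subgraph)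
  then show ?thesis using * by (simp add: D_def)
qed

theorem theorem3p1:
  fixes c1 c2 :: real
  assumes "c1 \<in> {0<..1}" and "c2 \<in> {0<..1}"
  shows "\<exists>\<epsilon>0>0. \<forall>\<epsilon>. 0 < \<epsilon> \<and> \<epsilon> < \<epsilon>0 \<longrightarrow>
    (\<forall>(k :: nat \<Rightarrow> nat) (d :: nat \<Rightarrow> nat) (V :: nat \<Rightarrow> 'a set) (E :: nat \<Rightarrow> 'a set set) (p :: nat \<Rightarrow> real).
       filterlim k at_top sequentially \<and>
       (\<forall>n. simple_graph (V n) (E n) \<and>
            card (V n) > k n \<and>
            d n \<ge> 1 \<and>
            real (d n) \<le> c1 * (1 - c2) * real (k n) \<and>
            max_degree (V n) (E n) = d n \<and>
            iso_const_at (V n) (E n) (k n) \<ge> c1 * real (d n) \<and>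
            p n = (1 + \<epsilon>) / (c2 * c1 * real (d n)))
       \<longrightarrow> (\<lambda>n. measure_pmf.prob (random_subgraph (E n) (p n))
              {F. \<exists>C \<in> graph_components (V n) F.
                    real (card C) \<ge> c1 * (1 - c2) * real (k n) / 4})
           \<longlonglongrightarrow> 1)"
proof (intro exI[of _ 1] conjI allI impI)
  fix \<epsilon> :: real and k d :: "nat \<Rightarrow> nat" and V :: "nat \<Rightarrow> 'a set" and E :: "nat \<Rightarrow> 'a set set"
    and p :: "nat \<Rightarrow> real"
  assume \<epsilon>: "0 < \<epsilon> \<and> \<epsilon> < 1"
  assume "filterlim k at_top sequentially \<and>
       (\<forall>n. simple_graph (V n) (E n) \<and>
            card (V n) > k n \<and>
            d n \<ge> 1 \<and>
            real (d n) \<le> c1 * (1 - c2) * real (k n) \<and>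
            max_degree (V n) (E n) = d n \<and>
            iso_const_at (V n) (E n) (k n) \<ge> c1 * real (d n) \<and>
            p n = (1 + \<epsilon>) / (c2 * c1 * real (d n)))"
  then have k: "filterlim k at_top sequentially"
    and graph: "\<And>n. simple_graph (V n) (E n)" "\<And>n. k n < card (V n)" "\<And>n. 1 \<le> d n"
      "\<And>n. real (d n) \<le> c1 * (1 - c2) * real (k n)" "\<And>n. max_degree (V n) (E n) = d n"
      "\<And>n. c1 * real (d n) \<le> iso_const_at (V n) (E n) (k n)"
      "\<And>n. p n = (1 + \<epsilon>) / (c2 * c1 * real (d n))"
    by auto
  define \<rho> where "\<rho> = (1 + \<epsilon>) * exp (- \<epsilon>)"
  define good where "good n = {F. \<exists>C \<in> graph_components (V n) F.
      real (card C) \<ge> c1 * (1 - c2) * real (k n) / 4}" for n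
  have "1 + \<epsilon> < exp \<epsilon>" using ln_add_one_self_less_self[of \<epsilon>] \<epsilon> by (metis add_pos_pos exp_less_mono exp_ln zero_less_one)
  then have \<rho>: "0 \<le> \<rho>" "\<rho> < 1" using \<epsilon> by (auto simp: \<rho>_def exp_minus field_simps)
  have lower: "1 - \<rho> ^ k n \<le> measure_pmf.prob (random_subgraph (E n) (p n)) (good n)" for n
  proof -
    have kn: "0 < k n" using graph(3,4)[of n] by (cases "k n") auto
    have "0 \<le> c1 * (1 - c2) * real (k n)" using assms by auto
    then have "measure_pmf.prob (random_subgraph (E n) (p n)) (- good n) \<le> \<rho> ^ k n"
      unfolding good_def \<rho>_def Collect_neg_eq[symmetric]
      using assms \<epsilon> graph[of n] kn
      by (intro prob_no_large_component_le[of c1 c2 _ _ _ _ "d n"]) auto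
    moreover have "measure_pmf.prob (random_subgraph (E n) (p n)) (- good n)
        = 1 - measure_pmf.prob (random_subgraph (E n) (p n)) (good n)"
      using measure_pmf.prob_compl[of "good n" "random_subgraph (E n) (p n)"]
      by (simp add: Compl_eq_Diff_UNIV)
    ultimately show ?thesis by linarith
  qed
  have "(\<lambda>n. \<rho> ^ k n) \<longlonglongrightarrow> 0"
    by (rule filterlim_compose[OF LIMSEQ_power_zero k]) (use \<rho> in simp)
  then have "(\<lambda>n. 1 - \<rho> ^ k n) \<longlonglongrightarrow> 1" using tendsto_diff[OF tendsto_const] by fastforce
  then have "(\<lambda>n. measure_pmf.prob (random_subgraph (E n) (p n)) (good n)) \<longlonglongrightarrow> 1"
    by (rule tendsto_sandwich[rotated 2, OF _ tendsto_const])
      (use lower measure_pmf.prob_le_1 in auto)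
  then show "(\<lambda>n. measure_pmf.prob (random_subgraph (E n) (p n))
              {F. \<exists>C \<in> graph_components (V n) F.
                    real (card C) \<ge> c1 * (1 - c2) * real (k n) / 4}) \<longlonglongrightarrow> 1"
    by (simp add: good_def)
qed simp

end
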